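(* For every positive integer $d$, the set $$\Omega_d = \{z\in CL : \text{there exists a } CL\text{-polynomial } p \text{ of degree } d \text{ satisfying } (\diamondsuit) \text{ with } p(z)=0\}$$ is connected (as a subspace of $\mathbb{C}$).
   Context: The critical line is $CL=\{z\in\mathbb{C} : \mathrm{Re}(z)=-\frac12\}$. A $CL$-polynomial of degree $d$ is a polynomial of the form $f(z)=b(z)\prod_{i=0}^{\lfloor d/2\rfloor-1}(z^2+z+c_i)$, where the $c_i$ are real numbers $\geq\frac14$ and, for a non-zero constant $a$, $b(z)=a$ if $d$ is even and $b(z)=a(2z+1)$ if $d$ is odd. For a polynomial $f$ of degree $d$, the $h^*$-polynomial is the polynomial $h^*(t)=\sum_{i=0}^d h^*_i t^i$ with $\sum_{k\ge 0} f(k)t^k=\frac{h^*(t)}{(1-t)^{d+1}}$; equivalently $f(z)=\sum_{i=0}^d h_i^*\binom{z+d-i}{d}$. Palindromic means $h^*_i=h^*_{d-i}$ for all $0\le i\le d$. Property $(\diamondsuit)$ means that all $h^*_i$ are real and $\ge 0$ and that $h^*$ is palindromic. *)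

theory Defs
  imports "HOL-Analysis.Analysis" "HOL-Computational_Algebra.Polynomial_FPS"
begin

definition critical_line :: "complex set" where
  "critical_line = {z. Re z = - 1 / 2}"

definition CL_poly :: "nat \<Rightarrow> complex poly \<Rightarrow> bool" where
  "CL_poly d f \<longleftrightarrow>
     (\<exists>(a::complex) (c::nat \<Rightarrow> real).
        a \<noteq> 0 \<and> (\<forall>i < d div 2. c i \<ge> 1 / 4) \<and>
        f = (if even d then [:a:] else smult a [:1, 2:]) *
            (\<Prod>i < d div 2. [:complex_of_real (c i), 1, 1:]))"

definition is_hstar_poly :: "complex poly \<Rightarrow> complex poly \<Rightarrow> bool" where
  "is_hstar_poly f h \<longleftrightarrow>
     degree h \<le> degree f \<and>
     Abs_fps (\<lambda>k. poly f (of_nat k)) = fps_of_poly h / (1 - fps_X) ^ (degree f + 1)"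

definition hstar_poly :: "complex poly \<Rightarrow> complex poly" where
  "hstar_poly f = (THE h. is_hstar_poly f h)"

lemma degree_CL_poly:
  assumes "CL_poly d f"
  shows "degree f = d"
proof -
  obtain a c where a: "a \<noteq> 0" and f: "f = (if even d then [:a:] else smult a [:1, 2:]) *
      (\<Prod>i < d div 2. [:complex_of_real (c i), 1, 1:])"
    using assms unfolding CL_poly_def by blast
  have "degree (\<Prod>i < d div 2. [:complex_of_real (c i), 1, 1:]) = (\<Sum>i < d div 2. 2)"
    by (subst degree_prod_eq_sum_degree) auto
  moreover have "(\<Prod>i < d div 2. [:complex_of_real (c i), 1, 1:]) \<noteq> 0"
    by (simp add: prod_zero_iff)
  moreover have "(if even d then [:a:] else smult a [:1, 2:]) \<noteq> 0"
    "degree (if even d then [:a:] else smult a [:1, 2:]) = d mod 2"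
    using a by (auto simp: odd_iff_mod_2_eq_one)
  ultimately show ?thesis unfolding f by (subst degree_mult_eq) auto
qed

lemma degree_forward_difference_less:
  fixes f :: "complex poly"
  assumes "degree f < Suc n" "n > 0"
  shows "degree (pcompose f [:1, 1:] - f) < n"
proof (cases "degree f = n")
  case False
  then have "degree f < n" using assms by simp
  then show ?thesis by (intro degree_diff_less) (simp_all add: degree_pcompose)
next
  case True
  have deg: "degree (pcompose f [:1, 1:]) = n" using True by (simp add: degree_pcompose)
  have "lead_coeff (pcompose f [:1, 1:]) = lead_coeff f"
    by (subst lead_coeff_comp) auto
  then have "coeff (pcompose f [:1, 1:] - f) n = 0" using deg True by simp
  moreover have "degree (pcompose f [:1, 1:] - f) \<le> n"
    using deg True by (intro degree_diff_le) auto
  ultimately show ?thesis using \<open>n > 0\<close>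
    by (metis degree_0 le_neq_implies_less leading_coeff_0_iff)
qed

lemma hstar_numerator_exists:
  fixes f :: "complex poly"
  assumes "degree f < n"
  shows "\<exists>h. degree h < n \<and>
    Abs_fps (\<lambda>k. poly f (of_nat k)) * (1 - fps_X) ^ n = fps_of_poly h"
  using assms
proof (induction n arbitrary: f)
  case 0
  then show ?case by simp
next
  case (Suc n)
  let ?g = "pcompose f [:1, 1:] - f"
  let ?F = "Abs_fps (\<lambda>k. poly f (of_nat k))"
  let ?G = "Abs_fps (\<lambda>k. poly ?g (of_nat k))"
  have step: "?F * (1 - fps_X) = fps_const (poly f 0) + fps_X * ?G"
  proof (rule fps_ext)
    fix k show "fps_nth (?F * (1 - fps_X)) k = fps_nth (fps_const (poly f 0) + fps_X * ?G) k"
      by (cases k) (simp_all add: right_diff_distrib poly_pcompose add_ac)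
  qed
  show ?case
  proof (cases "n = 0")
    case True
    then obtain c where "f = [:c:]" using Suc.prems by (auto elim: degree_eq_zeroE)
    then have "?G = 0" by (simp add: fps_eq_iff)
    then show ?thesis using step True
      by (intro exI[of _ "[:poly f 0:]"]) (simp add: fps_of_poly_const)
  next
    case False
    then have "degree ?g < n" using degree_forward_difference_less Suc.prems by blast
    from Suc.IH[OF this] obtain h where h: "degree h < n"
      "?G * (1 - fps_X) ^ n = fps_of_poly h" by blast
    let ?k = "smult (poly f 0) ([:1, -1:] ^ n) + pCons 0 h"
    have 1: "fps_of_poly [:1, -1::complex:] = 1 - fps_X"
      by (simp add: fps_of_poly_pCons fps_of_poly_const
          flip: fps_const_neg)
    have "degree (smult (poly f 0) ([:1, -1:] ^ n)) \<le> n"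
      by (rule order.trans[OF degree_smult_le]) (use degree_power_le[of "[:1, -1::complex:]" n] in simp)
    moreover have "degree (pCons 0 h) \<le> n"
      using h(1) by (metis Suc_leI degree_pCons_le le_trans)
    ultimately have "degree ?k < Suc n" using degree_add_le less_Suc_eq_le by blast
    moreover have "?F * (1 - fps_X) ^ Suc n = (?F * (1 - fps_X)) * (1 - fps_X) ^ n"
      by (simp add: mult.assoc)
    then have "?F * (1 - fps_X) ^ Suc n =
        fps_const (poly f 0) * (1 - fps_X) ^ n + fps_X * (?G * (1 - fps_X) ^ n)"
      unfolding step by (simp only: distrib_right mult.assoc)
    then have "?F * (1 - fps_X) ^ Suc n = fps_of_poly ?k"
      unfolding h(2) by (simp add: fps_of_poly_add fps_of_poly_smult fps_of_poly_power
          fps_of_poly_pCons 1 mult.commute)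
    ultimately show ?thesis by blast
  qed
qed

lemma is_hstar_poly_iff:
  "is_hstar_poly f h \<longleftrightarrow> degree h \<le> degree f \<and>
     Abs_fps (\<lambda>k. poly f (of_nat k)) * (1 - fps_X) ^ (degree f + 1) = fps_of_poly h"
proof -
  let ?D = "(1 - fps_X :: complex fps) ^ (degree f + 1)"
  have "fps_nth ?D 0 \<noteq> 0" by (simp add: fps_nth_power_0)
  then have "inverse ?D * ?D = 1" "fps_of_poly h / ?D = fps_of_poly h * inverse ?D"
    by (blast intro: inverse_mult_eq_1, blast intro: fps_divide_unit)
  moreover have "F = fps_of_poly h * J \<longleftrightarrow> F * E = fps_of_poly h"
    if "J * E = 1" for F J E :: "complex fps"
  proof
    assume "F = fps_of_poly h * J"
    then have "F * E = fps_of_poly h * (J * E)" by (simp only: mult.assoc)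
    then show "F * E = fps_of_poly h" using that by simp
  next
    assume F: "F * E = fps_of_poly h"
    have "fps_of_poly h * J = F * (J * E)" unfolding F[symmetric] by (simp only: mult_ac)
    then show "F = fps_of_poly h * J" using that by simp
  qed
  ultimately show ?thesis unfolding is_hstar_poly_def by metis
qed

lemma hstar_poly_unique_exists: "\<exists>!h. is_hstar_poly f h"
proof -
  obtain h where "is_hstar_poly f h"
    unfolding is_hstar_poly_iff using hstar_numerator_exists[of f "degree f + 1"] by auto
  moreover have "h' = h''" if "is_hstar_poly f h'" "is_hstar_poly f h''" for h' h''
    using that unfolding is_hstar_poly_iff by (metis fps_of_poly_eq_iff)
  ultimately show ?thesis by blast
qed

lemma is_hstar_poly_hstar_poly: "is_hstar_poly f (hstar_poly f)"
  unfolding hstar_poly_def by (rule theI'[OF hstar_poly_unique_exists])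

definition diamond :: "complex poly \<Rightarrow> bool" where
  "diamond f \<longleftrightarrow>
     (\<forall>i \<le> degree f. coeff (hstar_poly f) i \<in> \<real> \<and> Re (coeff (hstar_poly f) i) \<ge> 0) \<and>
     (\<forall>i \<le> degree f. coeff (hstar_poly f) i = coeff (hstar_poly f) (degree f - i))"

definition Omega :: "nat \<Rightarrow> complex set" where
  "Omega d = {z \<in> critical_line. \<exists>p. CL_poly d p \<and> diamond p \<and> poly p z = 0}"

end

theory Submission
  imports Defs "HOL-Computational_Algebra.Fundamental_Theorem_Algebra"
begin

text \<open>
  Put \<open>x = z + 1/2\<close>, so that the critical line is \<open>x = \<i>y\<close>. For \<open>y > 0\<close>, up to the common factor
  \<open>(\<i>y)\<^sup>d\<close> the binomials \<open>(z + d - i) gchoose d\<close> have argument of modulus at most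
  \<open>\<Theta> d y = (\<Sum>j<d. arctan ((j + 1/2) / y))\<close> at \<open>x = \<i>y\<close>. If \<open>\<Theta> d y < \<pi>/2\<close>, no nonnegative combination
  of them vanishes there. Conversely, if \<open>\<Theta> d y \<ge> \<pi>/2\<close>, there are \<open>m < d\<close> and \<open>0 < c \<le> m + 1/2\<close> with
  \<open>\<Theta> m y + arctan (c / y) = \<pi>/2\<close>, and the product of \<open>x\<^bsup>d-m-1\<^esup>\<close> with
  \<open>(x + c) * (\<Prod>j<m. x + j + 1/2) + (x - c) * (\<Prod>j<m. x - j - 1/2)\<close>
  vanishes at \<open>\<i>y\<close>. It has its roots on the line by the Hermite--Biehler argument. Its \<open>h\<^sup>*\<close> is
  nonnegative because it is a convex combination of the cases \<open>c = 0\<close> and \<open>c = m + 1/2\<close> and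
  multiplication by \<open>x\<close> preserves nonnegativity; it is palindromic because every \<open>CL\<close>-polynomial
  satisfies \<open>f (-1 - z) = (-1)\<^sup>d f z\<close>. As \<open>\<Theta> d y\<close> decreases in \<open>y\<close>, the set is a segment
  around \<open>-1/2\<close>.
\<close>

section \<open>Polynomials with all roots on the critical line\<close>

definition reflection_symmetric :: "complex poly \<Rightarrow> bool" where
  "reflection_symmetric f \<longleftrightarrow> pcompose f [:-1, -1:] = smult ((-1) ^ degree f) f"

lemma poly_reflection_symmetric:
  assumes "reflection_symmetric f"
  shows "poly f (- 1 - z) = (-1) ^ degree f * poly f z"
proof -
  have "poly f (- 1 - z) = poly (pcompose f [:-1, -1:]) z" by (simp add: poly_pcompose)
  then show ?thesis using assms by (simp add: reflection_symmetric_def)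
qed

lemma reflection_symmetric_mult_left_iff:
  assumes "reflection_symmetric f" "f \<noteq> 0"
  shows "reflection_symmetric (f * g) \<longleftrightarrow> reflection_symmetric g"
proof (cases "g = 0")
  case False
  let ?s = "(-1) ^ degree f :: complex"
  have "pcompose (f * g) [:-1, -1:] = smult ?s f * pcompose g [:-1, -1:]"
    using assms(1) by (simp add: reflection_symmetric_def pcompose_mult)
  moreover have "smult ((-1) ^ degree (f * g)) (f * g) = smult ?s f * smult ((-1) ^ degree g) g"
    using assms(2) False by (simp add: degree_mult_eq power_add mult.commute)
  moreover have "smult ?s f \<noteq> 0" using assms(2) by simp
  ultimately show ?thesis unfolding reflection_symmetric_def by (metis mult_left_cancel)
qed simp

definition critical_symmetric :: "complex poly \<Rightarrow> bool" where
  "critical_symmetric f \<longleftrightarrow> (\<forall>z. poly f z = 0 \<longrightarrow> z \<in> critical_line) \<and> reflection_symmetric f"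

lemma critical_symmetric_nonzero:
  assumes "critical_symmetric f"
  shows "f \<noteq> 0"
proof
  assume "f = 0"
  then have "0 \<in> critical_line" using assms by (simp add: critical_symmetric_def)
  then show False by (simp add: critical_line_def)
qed

lemma critical_symmetric_mult_left_iff:
  assumes "critical_symmetric f"
  shows "critical_symmetric (f * g) \<longleftrightarrow> critical_symmetric g"
  using assms reflection_symmetric_mult_left_iff[of f g] critical_symmetric_nonzero[OF assms]
  by (auto simp: critical_symmetric_def)

lemma critical_symmetric_linear_iff:
  "degree f = 1 \<and> critical_symmetric f \<longleftrightarrow> (\<exists>a\<noteq>0. f = smult a [:1, 2:])"
proof
  assume symmetric: "degree f = 1 \<and> critical_symmetric f"
  then obtain a b where linear: "f = [:b, a:]" "a \<noteq> 0"
    by (cases f) (auto elim!: degree_eq_zeroE split: if_splits)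
  then have "a = 2 * b"
    using symmetric by (simp add: critical_symmetric_def reflection_symmetric_def pcompose_pCons)
  then show "\<exists>a\<noteq>0. f = smult a [:1, 2:]" using linear by (intro exI[of _ b]) auto
next
  assume "\<exists>a\<noteq>0. f = smult a [:1, 2:]"
  then obtain a where "a \<noteq> 0" and f_eq: "f = smult a [:1, 2:]" by blast
  have "z \<in> critical_line" if "poly f z = 0" for z
  proof -
    have "poly f z = a * (1 + 2 * z)" unfolding f_eq by (simp add: algebra_simps)
    then have "1 + 2 * z = 0" using that \<open>a \<noteq> 0\<close> by simp
    then show ?thesis by (simp add: critical_line_def complex_eq_iff)
  qed
  moreover have "reflection_symmetric f"
    unfolding f_eq using \<open>a \<noteq> 0\<close> by (simp add: reflection_symmetric_def pcompose_pCons)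
  ultimately show "degree f = 1 \<and> critical_symmetric f"
    using f_eq \<open>a \<noteq> 0\<close> by (simp add: critical_symmetric_def)
qed

lemma critical_symmetric_quadratic:
  assumes "c \<ge> 1/4"
  shows "critical_symmetric [:complex_of_real c, 1, 1:]"
proof -
  have "z \<in> critical_line" if "poly [:complex_of_real c, 1, 1:] z = 0" for z
  proof -
    have real_part: "c + Re z + (Re z)\<^sup>2 = (Im z)\<^sup>2"
      and imaginary_part: "Im z * (1 + 2 * Re z) = 0"
      using that by (simp_all add: complex_eq_iff algebra_simps power2_eq_square)
    have "Re z = - 1/2" if "Im z = 0"
    proof -
      have "(Re z + 1/2)\<^sup>2 = 1/4 - c"
        using real_part that by (simp add: power2_eq_square algebra_simps)
      then have "(Re z + 1/2)\<^sup>2 = 0" using assms zero_le_power2[of "Re z + 1/2"] by linarith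
      then show ?thesis by simp
    qed
    then show ?thesis using imaginary_part by (auto simp: critical_line_def)
  qed
  moreover have "reflection_symmetric [:complex_of_real c, 1, 1:]"
    by (simp add: reflection_symmetric_def pcompose_pCons)
  ultimately show ?thesis unfolding critical_symmetric_def by blast
qed

lemma cnj_critical_line: "z \<in> critical_line \<Longrightarrow> cnj z = - 1 - z"
  by (simp add: critical_line_def complex_eq_iff)

lemma reflected_linear_factors_dvd:
  assumes "2 \<le> degree f" "critical_symmetric f"
  obtains z where "poly f z = 0" "[:- z, 1:] * [:1 + z, 1:] dvd f"
proof (cases "\<exists>z. poly f z = 0 \<and> z \<noteq> - 1/2")
  case True
  then obtain z where root: "poly f z = 0" "z \<noteq> - 1/2" by blast
  then obtain g where f_eq: "f = [:- z, 1:] * g" using poly_eq_0_iff_dvd dvdE by metis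
  have "poly f (- 1 - z) = 0"
    using assms(2) poly_reflection_symmetric root(1) by (simp add: critical_symmetric_def)
  moreover have "poly f (- 1 - z) = - ((1 + 2 * z) * poly g (- 1 - z))"
    unfolding f_eq by (simp add: algebra_simps)
  moreover have "1 + 2 * z \<noteq> 0" using root(2) by (auto simp: complex_eq_iff)
  ultimately have "poly g (- 1 - z) = 0" by simp
  then have "[:1 + z, 1:] dvd g" by (simp add: poly_eq_0_iff_dvd add.commute)
  then have "[:- z, 1:] * [:1 + z, 1:] dvd f" unfolding f_eq by (rule mult_dvd_mono[OF dvd_refl])
  then show ?thesis using that root(1) by blast
next
  case False
  obtain z where root: "poly f z = 0" using alg_closed_imp_poly_has_root[of f] assms(1) by auto
  then obtain g where f_eq: "f = [:- z, 1:] * g" using poly_eq_0_iff_dvd dvdE by metis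
  then have "degree g \<noteq> 0" using assms(1) degree_mult_le[of "[:- z, 1:]" g] by auto
  then obtain w where root_g: "poly g w = 0" using alg_closed_imp_poly_has_root[of g] by auto
  then have "poly f w = 0" unfolding f_eq by simp
  then have "w = - 1/2" "z = - 1/2" using False root by blast+
  then have "[:1 + z, 1:] dvd g" using root_g by (simp add: poly_eq_0_iff_dvd)
  then have "[:- z, 1:] * [:1 + z, 1:] dvd f" unfolding f_eq by (rule mult_dvd_mono[OF dvd_refl])
  then show ?thesis using that root by blast
qed

lemma critical_quadratic_dvd:
  assumes "2 \<le> degree f" "critical_symmetric f"
  obtains c where "c \<ge> 1/4" "[:complex_of_real c, 1, 1:] dvd f"
proof -
  obtain z where factors: "poly f z = 0" "[:- z, 1:] * [:1 + z, 1:] dvd f"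
    using reflected_linear_factors_dvd assms by blast
  then have on_line: "z \<in> critical_line"
    using assms(2) by (simp add: critical_symmetric_def)
  have "complex_of_real ((cmod z)\<^sup>2) = - z * (1 + z)"
    unfolding complex_norm_square cnj_critical_line[OF on_line] by (simp add: algebra_simps)
  then have "[:complex_of_real ((cmod z)\<^sup>2), 1, 1:] = [:- z, 1:] * [:1 + z, 1:]"
    by (simp add: algebra_simps)
  moreover have "(cmod z)\<^sup>2 \<ge> 1/4"
    using on_line by (simp add: cmod_power2 critical_line_def power_divide)
  ultimately show ?thesis using that factors(2) by metis
qed

lemma CL_poly_0_iff: "CL_poly 0 f \<longleftrightarrow> (\<exists>a\<noteq>0. f = [:a:])"
  by (auto simp: CL_poly_def)

lemma CL_poly_1_iff: "CL_poly 1 f \<longleftrightarrow> (\<exists>a\<noteq>0. f = smult a [:1, 2:])"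
  by (auto simp: CL_poly_def)

lemma CL_poly_add_2_iff:
  "CL_poly (d + 2) f \<longleftrightarrow> (\<exists>c\<ge>1/4. \<exists>g. CL_poly d g \<and> f = [:complex_of_real c, 1, 1:] * g)"
proof -
  let ?q = "\<lambda>c. [:complex_of_real c, 1, 1:]"
    and ?b = "\<lambda>a. if even d then [:a:] else smult a [:1, 2:]"
  show ?thesis
  proof
    assume "CL_poly (d + 2) f"
    then obtain a c where factors: "a \<noteq> 0" "\<forall>i < (d + 2) div 2. c i \<ge> (1/4 :: real)"
      "f = ?b a * (\<Prod>i < (d + 2) div 2. ?q (c i))"
      unfolding CL_poly_def by auto
    have "f = ?q (c (d div 2)) * (?b a * (\<Prod>i < d div 2. ?q (c i)))"
      unfolding factors(3) by (simp add: mult_ac del: mult_pCons_left mult_pCons_right)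
    moreover have "CL_poly d (?b a * (\<Prod>i < d div 2. ?q (c i)))"
      unfolding CL_poly_def using factors(1,2) by (intro exI[of _ a] exI[of _ c]) auto
    moreover have "c (d div 2) \<ge> 1/4" using factors(2) by simp
    ultimately show "\<exists>c\<ge>1/4. \<exists>g. CL_poly d g \<and> f = ?q c * g" by blast
  next
    assume "\<exists>c\<ge>1/4. \<exists>g. CL_poly d g \<and> f = ?q c * g"
    then obtain c a e where factors: "c \<ge> 1/4" "a \<noteq> 0"
      "\<forall>i < d div 2. e i \<ge> (1/4 :: real)"
      "f = ?q c * (?b a * (\<Prod>i < d div 2. ?q (e i)))"
      unfolding CL_poly_def by auto
    let ?e = "e(d div 2 := c)"
    have "f = ?b a * (\<Prod>i < (d + 2) div 2. ?q (?e i))"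
      unfolding factors(4) by (simp add: mult_ac del: mult_pCons_left mult_pCons_right)
    then show "CL_poly (d + 2) f"
      unfolding CL_poly_def using factors(1-3) by (intro exI[of _ a] exI[of _ ?e]) auto
  qed
qed

lemma critical_quadratic_mult_iff:
  assumes "c \<ge> 1/4"
  shows "degree ([:complex_of_real c, 1, 1:] * g) = d + 2 \<and>
      critical_symmetric ([:complex_of_real c, 1, 1:] * g) \<longleftrightarrow> degree g = d \<and> critical_symmetric g"
proof (cases "g = 0")
  case False
  then have "degree ([:complex_of_real c, 1, 1:] * g) = degree g + 2"
    by (subst degree_mult_eq) auto
  then show ?thesis
    unfolding critical_symmetric_mult_left_iff[OF critical_symmetric_quadratic[OF assms]] by simp
qed (use critical_symmetric_nonzero[of 0] in auto)

lemma CL_poly_iff: "CL_poly d f \<longleftrightarrow> degree f = d \<and> critical_symmetric f"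
proof (induction d arbitrary: f rule: nat_induct2)
  case 0
  show ?case
  proof (cases "degree f = 0")
    case True
    then obtain a where f_eq: "f = [:a:]" by (rule degree_eq_zeroE)
    have "critical_symmetric f" if "a \<noteq> 0"
      using that by (simp add: f_eq critical_symmetric_def reflection_symmetric_def)
    then show ?thesis
      using critical_symmetric_nonzero[of f] by (auto simp: CL_poly_0_iff f_eq)
  qed (auto simp: CL_poly_0_iff)
next
  case 1
  show ?case unfolding CL_poly_1_iff critical_symmetric_linear_iff ..
next
  case (step d)
  show ?case
  proof
    assume symmetric: "degree f = d + 2 \<and> critical_symmetric f"
    then obtain c where "c \<ge> 1/4" "[:complex_of_real c, 1, 1:] dvd f"
      using critical_quadratic_dvd[of f] by auto
    moreover from this obtain g where f_eq: "f = [:complex_of_real c, 1, 1:] * g" by blast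
    ultimately have "CL_poly d g" using symmetric critical_quadratic_mult_iff step by blast
    then show "CL_poly (d + 2) f" unfolding CL_poly_add_2_iff using \<open>c \<ge> 1/4\<close> f_eq by blast
  next
    assume "CL_poly (d + 2) f"
    then show "degree f = d + 2 \<and> critical_symmetric f"
      unfolding CL_poly_add_2_iff using critical_quadratic_mult_iff step by blast
  qed
qed

lemma CL_poly_mult:
  assumes "CL_poly m f" "CL_poly n g"
  shows "CL_poly (m + n) (f * g)"
proof -
  have "f \<noteq> 0" "g \<noteq> 0" using assms critical_symmetric_nonzero by (auto simp: CL_poly_iff)
  then show ?thesis
    using assms by (simp add: CL_poly_iff critical_symmetric_mult_left_iff degree_mult_eq)
qed

lemma CL_poly_half_shift: "CL_poly 1 [:1/2, 1:]"
  unfolding CL_poly_1_iff by (intro exI[of _ "1/2"]) simp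

section \<open>The binomial basis\<close>

definition shifted_binom :: "nat \<Rightarrow> nat \<Rightarrow> complex poly" where
  "shifted_binom d i = smult (1 / fact d) (\<Prod>j<d. [:of_nat d - of_nat i - of_nat j, 1:])"

lemma poly_shifted_binom: "poly (shifted_binom d i) z = (z + of_nat d - of_nat i) gchoose d"
  by (simp add: shifted_binom_def poly_prod gbinomial_prod_rev atLeast0LessThan algebra_simps)

lemma degree_shifted_binom: "degree (shifted_binom d i) = d"
proof -
  have "degree (\<Prod>j<d. [:of_nat d - of_nat i - of_nat j, 1 :: complex:]) = d"
    by (subst degree_prod_eq_sum_degree) auto
  then show ?thesis by (simp add: shifted_binom_def)
qed

lemma poly_shifted_binom_of_nat:
  assumes "i \<le> d"
  shows "poly (shifted_binom d i) (of_nat k) = of_nat ((k + d - i) choose d)"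
  using assms by (simp add: poly_shifted_binom binomial_gbinomial of_nat_diff)

lemma pcompose_shifted_binom:
  assumes "i \<le> d"
  shows "pcompose (shifted_binom d i) [:-1, -1:] = smult ((-1) ^ d) (shifted_binom d (d - i))"
proof (rule poly_ext)
  fix z
  have "poly (pcompose (shifted_binom d i) [:-1, -1:]) z =
      (- (z + 1 + of_nat i - of_nat d)) gchoose d"
    by (simp add: poly_pcompose poly_shifted_binom algebra_simps)
  also have "\<dots> = (-1) ^ d * ((z + of_nat i) gchoose d)"
    by (subst gbinomial_minus) simp
  finally show "poly (pcompose (shifted_binom d i) [:-1, -1:]) z =
      poly (smult ((-1) ^ d) (shifted_binom d (d - i))) z"
    using assms by (simp add: poly_shifted_binom of_nat_diff)
qed

lemma half_shift_mult_shifted_binom: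
  assumes "i \<le> n"
  shows "[:1/2, 1:] * shifted_binom n i =
     smult (of_real (real i + 1/2)) (shifted_binom (Suc n) i) +
     smult (of_real (real (n - i) + 1/2)) (shifted_binom (Suc n) (Suc i))"
proof (rule poly_ext)
  fix z :: complex
  define w where "w = z + of_nat n - of_nat i"
  have "of_nat (Suc n) * (w gchoose Suc n) = (w - of_nat n) * (w gchoose n)"
    using gbinomial_mult_1[of w n] by (simp add: algebra_simps)
  moreover have "(w + 1) gchoose Suc n = (w gchoose n) + (w gchoose Suc n)"
    by (rule gbinomial_Suc_Suc)
  ultimately have "(of_nat i + 1/2) * ((w + 1) gchoose Suc n) +
      (of_nat n - of_nat i + 1/2) * (w gchoose Suc n) = (z + 1/2) * (w gchoose n)"
    by (simp add: w_def algebra_simps)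
  then show "poly ([:1/2, 1:] * shifted_binom n i) z =
      poly (smult (of_real (real i + 1/2)) (shifted_binom (Suc n) i) +
        smult (of_real (real (n - i) + 1/2)) (shifted_binom (Suc n) (Suc i))) z"
    using assms by (simp add: poly_shifted_binom w_def of_nat_diff algebra_simps)
qed

section \<open>Nonnegative and palindromic h*-vectors\<close>

definition hstar_series :: "nat \<Rightarrow> complex poly \<Rightarrow> complex fps" where
  "hstar_series d f = Abs_fps (\<lambda>k. poly f (of_nat k)) * (1 - fps_X) ^ (d + 1)"

lemma fps_of_poly_hstar_poly: "fps_of_poly (hstar_poly f) = hstar_series (degree f) f"
  using is_hstar_poly_hstar_poly[of f] unfolding is_hstar_poly_iff hstar_series_def by simp

lemma coeff_hstar_poly: "coeff (hstar_poly f) i = fps_nth (hstar_series (degree f) f) i"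
  by (simp flip: fps_of_poly_hstar_poly)

lemma fps_nth_hstar_series_eq_0:
  assumes "degree f \<le> d" "d < k"
  shows "fps_nth (hstar_series d f) k = 0"
proof -
  obtain h where "degree h < d + 1" "hstar_series d f = fps_of_poly h"
    using hstar_numerator_exists[of f "d + 1"] assms(1) unfolding hstar_series_def by auto
  then show ?thesis using assms(2) by (simp add: coeff_eq_0)
qed

lemma hstar_series_add: "hstar_series d (f + g) = hstar_series d f + hstar_series d g"
proof -
  have "Abs_fps (\<lambda>k. poly (f + g) (of_nat k)) =
      Abs_fps (\<lambda>k. poly f (of_nat k)) + Abs_fps (\<lambda>k. poly g (of_nat k))"
    by (simp add: fps_eq_iff)
  then show ?thesis by (simp only: hstar_series_def distrib_right)
qed

lemma hstar_series_smult: "hstar_series d (smult c f) = fps_const c * hstar_series d f"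
proof -
  have "Abs_fps (\<lambda>k. poly (smult c f) (of_nat k)) = fps_const c * Abs_fps (\<lambda>k. poly f (of_nat k))"
    by (simp add: fps_eq_iff)
  then show ?thesis by (simp only: hstar_series_def mult.assoc)
qed

lemma hstar_series_0: "hstar_series d 0 = 0"
  using hstar_series_smult[of d 0 0] by simp

lemma hstar_series_sum: "hstar_series d (\<Sum>i\<in>A. f i) = (\<Sum>i\<in>A. hstar_series d (f i))"
  by (induction A rule: infinite_finite_induct) (simp_all add: hstar_series_0 hstar_series_add)

lemma hstar_series_eq_iff: "hstar_series d f = hstar_series d g \<longleftrightarrow> f = g"
proof
  assume "hstar_series d f = hstar_series d g"
  moreover have "fps_nth ((1 - fps_X) ^ (d + 1) :: complex fps) 0 \<noteq> 0"
    by (simp add: fps_nth_power_0)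
  then have "(1 - fps_X :: complex fps) ^ (d + 1) \<noteq> 0" by (metis fps_zero_nth)
  ultimately have "Abs_fps (\<lambda>k. poly f (of_nat k)) = Abs_fps (\<lambda>k. poly g (of_nat k))"
    unfolding hstar_series_def using mult_right_cancel by blast
  then have "range of_nat \<subseteq> {x. poly (f - g) x = 0}" by (auto simp: fps_eq_iff)
  then have "infinite {x. poly (f - g) x = 0}"
    using infinite_super range_inj_infinite inj_of_nat by blast
  then have "f - g = 0" using poly_roots_finite by blast
  then show "f = g" by simp
qed simp

lemma hstar_series_shifted_binom:
  assumes "i \<le> d"
  shows "hstar_series d (shifted_binom d i) = fps_X ^ i"
proof -
  have inverse: "inverse ((1 - fps_X) ^ (d + 1) :: complex fps) =
      Abs_fps (\<lambda>k. of_nat ((d + k) choose k))"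
    using one_minus_const_fps_X_neg_power'[of "d + 1" "1::complex"] by simp
  have "Abs_fps (\<lambda>k. poly (shifted_binom d i) (of_nat k)) =
      fps_X ^ i * Abs_fps (\<lambda>k. of_nat ((d + k) choose k))"
  proof (rule fps_ext)
    fix k
    have "(k + d - i) choose d = (d + (k - i)) choose (k - i)" if "i \<le> k"
      using that binomial_symmetric[of d "d + (k - i)"] by (simp add: add.commute)
    moreover have "(k + d - i) choose d = 0" if "k < i"
      using that assms by (intro binomial_eq_0) auto
    ultimately show "fps_nth (Abs_fps (\<lambda>k. poly (shifted_binom d i) (of_nat k))) k =
        fps_nth (fps_X ^ i * Abs_fps (\<lambda>k. of_nat ((d + k) choose k))) k"
      using assms by (simp add: poly_shifted_binom_of_nat fps_X_power_mult_nth)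
  qed
  moreover have "inverse ((1 - fps_X) ^ (d + 1) :: complex fps) * (1 - fps_X) ^ (d + 1) = 1"
    by (rule inverse_mult_eq_1) (simp add: fps_nth_power_0)
  ultimately show ?thesis
    unfolding hstar_series_def inverse[symmetric] by (simp only: mult.assoc mult_1_right)
qed

lemma fps_nth_hstar_series_binom_sum:
  "fps_nth (hstar_series d (\<Sum>i\<le>d. smult (c i) (shifted_binom d i))) k = (if k \<le> d then c k else 0)"
proof -
  have "hstar_series d (\<Sum>i\<le>d. smult (c i) (shifted_binom d i)) =
      (\<Sum>i\<le>d. fps_const (c i) * fps_X ^ i)"
    unfolding hstar_series_sum
    by (intro sum.cong refl) (simp add: hstar_series_smult hstar_series_shifted_binom)
  then show ?thesis
    by (simp add: fps_sum_nth fps_X_power_iff if_distrib cong: if_cong)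
qed

lemma hstar_binom_expansion:
  assumes "degree f \<le> d"
  shows "f = (\<Sum>i\<le>d. smult (fps_nth (hstar_series d f) i) (shifted_binom d i))"
proof -
  have "hstar_series d f =
      hstar_series d (\<Sum>i\<le>d. smult (fps_nth (hstar_series d f) i) (shifted_binom d i))"
    using fps_nth_hstar_series_eq_0[OF assms]
    by (auto simp: fps_eq_iff fps_nth_hstar_series_binom_sum)
  then show ?thesis by (simp only: hstar_series_eq_iff)
qed

lemma hstar_series_palindromic:
  assumes "reflection_symmetric f" "i \<le> degree f"
  shows "fps_nth (hstar_series (degree f) f) i = fps_nth (hstar_series (degree f) f) (degree f - i)"
proof -
  define d where "d = degree f"
  let ?h = "fps_nth (hstar_series d f)" and ?s = "(-1) ^ d :: complex"
  have "smult ?s f = pcompose f [:-1, -1:]"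
    using assms(1) by (simp add: reflection_symmetric_def d_def)
  also have "\<dots> = pcompose (\<Sum>i\<le>d. smult (?h i) (shifted_binom d i)) [:-1, -1:]"
    using hstar_binom_expansion[of f d] by (simp add: d_def)
  also have "\<dots> = (\<Sum>i\<le>d. smult (?s * ?h i) (shifted_binom d (d - i)))"
    by (simp add: pcompose_sum pcompose_smult pcompose_shifted_binom mult.commute)
  also have "\<dots> = (\<Sum>i\<le>d. smult (?s * ?h (d - i)) (shifted_binom d i))"
    by (rule sum.reindex_bij_witness[of _ "\<lambda>i. d - i" "\<lambda>i. d - i"]) auto
  finally have "?s * ?h i = fps_nth (hstar_series d \<dots>) i"
    by (metis hstar_series_smult fps_mult_left_const_nth)
  also have "\<dots> = ?s * ?h (d - i)"
    using assms(2) by (simp only: fps_nth_hstar_series_binom_sum d_def if_True)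
  finally show ?thesis by (simp add: d_def)
qed

definition hstar_nonneg :: "nat \<Rightarrow> complex poly \<Rightarrow> bool" where
  "hstar_nonneg d f \<longleftrightarrow> degree f \<le> d \<and> (\<forall>i. fps_nth (hstar_series d f) i \<in> \<real>\<^sub>\<ge>\<^sub>0)"

lemma hstar_nonneg_shifted_binom: "i \<le> d \<Longrightarrow> hstar_nonneg d (shifted_binom d i)"
  by (simp add: hstar_nonneg_def degree_shifted_binom hstar_series_shifted_binom fps_X_power_iff)

lemma hstar_nonneg_add: "hstar_nonneg d f \<Longrightarrow> hstar_nonneg d g \<Longrightarrow> hstar_nonneg d (f + g)"
  by (simp add: hstar_nonneg_def hstar_series_add degree_add_le)

lemma hstar_nonneg_smult:
  assumes "hstar_nonneg d f" "c \<in> \<real>\<^sub>\<ge>\<^sub>0"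
  shows "hstar_nonneg d (smult c f)"
  using assms by (simp add: hstar_nonneg_def hstar_series_smult)

lemma hstar_nonneg_sum: "(\<And>i. i \<in> A \<Longrightarrow> hstar_nonneg d (f i)) \<Longrightarrow> hstar_nonneg d (\<Sum>i\<in>A. f i)"
  by (induction A rule: infinite_finite_induct)
    (simp_all add: hstar_nonneg_add hstar_nonneg_def[of _ 0] hstar_series_0)

lemma hstar_nonneg_half_shift_mult:
  assumes "hstar_nonneg n f"
  shows "hstar_nonneg (Suc n) ([:1/2, 1:] * f)"
proof -
  let ?h = "fps_nth (hstar_series n f)"
  have binom: "hstar_nonneg (Suc n) ([:1/2, 1:] * shifted_binom n i)" if "i \<le> n" for i
    unfolding half_shift_mult_shifted_binom[OF that] using that
    by (intro hstar_nonneg_add hstar_nonneg_smult hstar_nonneg_shifted_binom)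
      (auto simp del: of_real_add)
  have "[:1/2, 1:] * f = [:1/2, 1:] * (\<Sum>i\<le>n. smult (?h i) (shifted_binom n i))"
    using hstar_binom_expansion[of f n] assms by (simp only: hstar_nonneg_def)
  also have "\<dots> = (\<Sum>i\<le>n. smult (?h i) ([:1/2, 1:] * shifted_binom n i))"
    by (simp only: sum_distrib_left mult_smult_right)
  also have "hstar_nonneg (Suc n) \<dots>"
    using assms binom
    by (intro hstar_nonneg_sum hstar_nonneg_smult) (simp_all add: hstar_nonneg_def)
  finally show ?thesis .
qed

lemma diamond_iff_hstar_nonneg:
  assumes "CL_poly d f"
  shows "diamond f \<longleftrightarrow> hstar_nonneg d f"
proof -
  have degree: "degree f = d" and symmetric: "reflection_symmetric f"
    using assms by (simp_all add: CL_poly_iff critical_symmetric_def)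
  have "c \<in> \<real> \<and> Re c \<ge> 0 \<longleftrightarrow> c \<in> \<real>\<^sub>\<ge>\<^sub>0" for c
    by (auto simp: complex_nonneg_Reals_iff complex_is_Real_iff)
  then have "diamond f \<longleftrightarrow> (\<forall>i\<le>d. fps_nth (hstar_series d f) i \<in> \<real>\<^sub>\<ge>\<^sub>0)"
    using hstar_series_palindromic[OF symmetric]
    unfolding diamond_def coeff_hstar_poly degree by blast
  moreover have "fps_nth (hstar_series d f) i \<in> \<real>\<^sub>\<ge>\<^sub>0" if "\<not> i \<le> d" for i
    using that degree by (simp add: fps_nth_hstar_series_eq_0)
  ultimately show ?thesis unfolding hstar_nonneg_def degree by blast
qed

section \<open>Products of linear factors on the critical line\<close>

text \<open>The factors are \<open>x + \<kappa> j\<close> in the variable \<open>x = z + 1/2\<close>.\<close>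
definition line_prod :: "(nat \<Rightarrow> real) \<Rightarrow> nat \<Rightarrow> complex poly" where
  "line_prod \<kappa> n = (\<Prod>j<n. [:1/2 + of_real (\<kappa> j), 1:])"

definition symmetrized_prod :: "(nat \<Rightarrow> real) \<Rightarrow> nat \<Rightarrow> complex poly" where
  "symmetrized_prod \<kappa> n = line_prod \<kappa> n + line_prod (\<lambda>j. - \<kappa> j) n"

lemma line_prod_Suc: "line_prod \<kappa> (Suc n) = [:1/2 + of_real (\<kappa> n), 1:] * line_prod \<kappa> n"
  by (simp add: line_prod_def mult.commute del: mult_pCons_left mult_pCons_right)

lemma poly_line_prod: "poly (line_prod \<kappa> n) z = (\<Prod>j<n. z + 1/2 + of_real (\<kappa> j))"
  by (simp add: line_prod_def poly_prod algebra_simps)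

lemma degree_line_prod: "degree (line_prod \<kappa> n) = n"
  unfolding line_prod_def by (subst degree_prod_eq_sum_degree) auto

lemma lead_coeff_line_prod: "coeff (line_prod \<kappa> n) n = 1"
  using lead_coeff_prod[of "\<lambda>j. [:1/2 + of_real (\<kappa> j), 1::complex:]" "{..<n}"]
    degree_line_prod[of \<kappa> n]
  by (simp add: line_prod_def)

lemma pcompose_line_prod:
  "pcompose (line_prod \<kappa> n) [:-1, -1:] = smult ((-1) ^ n) (line_prod (\<lambda>j. - \<kappa> j) n)"
proof -
  have "pcompose [:1/2 + of_real r, 1:] [:-1, -1:] =
      smult (-1) [:1/2 + of_real (- r), 1 :: complex:]" for r
    by (simp add: pcompose_pCons)
  then show ?thesis
    by (simp only: line_prod_def pcompose_prod prod_smult prod_constant card_lessThan)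
qed

lemma degree_symmetrized_prod: "degree (symmetrized_prod \<kappa> n) = n"
proof (rule antisym)
  show "degree (symmetrized_prod \<kappa> n) \<le> n"
    by (simp add: symmetrized_prod_def degree_add_le degree_line_prod)
  show "n \<le> degree (symmetrized_prod \<kappa> n)"
    by (rule le_degree) (simp add: symmetrized_prod_def lead_coeff_line_prod)
qed

lemma reflection_symmetric_symmetrized_prod: "reflection_symmetric (symmetrized_prod \<kappa> n)"
  unfolding reflection_symmetric_def degree_symmetrized_prod
  by (simp add: symmetrized_prod_def pcompose_add pcompose_line_prod smult_add_right add.commute)

lemma norm_poly_line_prod_less:
  assumes "Re z > - 1/2" "n > 0" "\<And>j. j < n \<Longrightarrow> \<kappa> j > 0"
  shows "norm (poly (line_prod (\<lambda>j. - \<kappa> j) n) z) < norm (poly (line_prod \<kappa> n) z)"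
proof -
  have "norm (z + 1/2 - of_real (\<kappa> j)) < norm (z + 1/2 + of_real (\<kappa> j))" if "j < n" for j
  proof -
    have "\<bar>Re z + 1/2 - \<kappa> j\<bar> < \<bar>Re z + 1/2 + \<kappa> j\<bar>" using assms(1) assms(3)[OF that] by auto
    then have "(Re z + 1/2 - \<kappa> j)\<^sup>2 < (Re z + 1/2 + \<kappa> j)\<^sup>2"
      using abs_le_square_iff not_less by metis
    then show ?thesis by (simp add: cmod_def)
  qed
  moreover have "z + 1/2 + of_real (\<kappa> j) \<noteq> 0" if "j < n" for j
    using assms(1) assms(3)[OF that] by (auto simp: complex_eq_iff)
  ultimately show ?thesis
    unfolding poly_line_prod prod_norm[symmetric] using assms(2)
    by (intro prod_mono_strict[of 0]) (auto intro: less_imp_le)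
qed

text \<open>The Hermite--Biehler argument: to the right of the critical line the first product
  strictly dominates the second in modulus, and the symmetry takes care of the left side.\<close>
lemma CL_poly_symmetrized_prod:
  assumes "\<And>j. j < n \<Longrightarrow> \<kappa> j > 0"
  shows "CL_poly n (symmetrized_prod \<kappa> n)"
proof -
  let ?F = "symmetrized_prod \<kappa> n"
  have not_right: "\<not> Re z > - 1/2" if "poly ?F z = 0" for z
  proof
    assume right: "Re z > - 1/2"
    have "n > 0" using that by (cases n) (simp_all add: symmetrized_prod_def line_prod_def)
    have "poly (line_prod \<kappa> n) z = - poly (line_prod (\<lambda>j. - \<kappa> j) n) z"
      using that by (simp add: symmetrized_prod_def add_eq_0_iff2)
    then show False using norm_poly_line_prod_less[of z n \<kappa>] right \<open>n > 0\<close> assms by simp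
  qed
  have "z \<in> critical_line" if "poly ?F z = 0" for z
  proof -
    have "poly ?F (- 1 - z) = 0"
      using that poly_reflection_symmetric[OF reflection_symmetric_symmetrized_prod] by simp
    then have "\<not> Re z < - 1/2" using not_right[of "- 1 - z"] by simp
    then show ?thesis using not_right[OF that] by (simp add: critical_line_def)
  qed
  then show ?thesis
    by (simp add: CL_poly_iff critical_symmetric_def degree_symmetrized_prod
        reflection_symmetric_symmetrized_prod)
qed

definition half_int :: "nat \<Rightarrow> real" where
  "half_int j = real j + 1/2"

lemma half_int_pos: "half_int j > 0"
  by (simp add: half_int_def)

lemma shifted_binom_eq_line_prod:
  "shifted_binom (m + n) n =
     smult (1 / fact (m + n)) (line_prod half_int m * line_prod (\<lambda>j. - half_int j) n)"
proof -
  have "(\<Prod>j<m + n. [:of_nat m - of_nat j, 1:]) =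
      line_prod half_int m * line_prod (\<lambda>j. - half_int j) n"
  proof (induction n)
    case 0
    have "(\<Prod>j<m. [:of_nat m - of_nat j, 1 :: complex:]) = (\<Prod>j<m. [:1 + of_nat (m - Suc j), 1:])"
      by (intro prod.cong) (auto simp: of_nat_diff)
    also have "\<dots> = (\<Prod>j<m. [:1 + of_nat j, 1:])" by (rule prod.nat_diff_reindex)
    finally show ?case by (simp add: line_prod_def half_int_def)
  next
    case (Suc n)
    have "[:of_nat m - of_nat (m + n), 1:] = [:1/2 + of_real (- half_int n), 1 :: complex:]"
      by (simp add: half_int_def)
    then show ?case
      by (simp only: add_Suc_right prod.lessThan_Suc Suc line_prod_Suc mult_ac)
  qed
  then show ?thesis by (simp add: shifted_binom_def)
qed

lemma hstar_nonneg_symmetrized_half_int: "hstar_nonneg n (symmetrized_prod half_int n)"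
proof -
  have "symmetrized_prod half_int n = smult (fact n) (shifted_binom n 0 + shifted_binom n n)"
    using shifted_binom_eq_line_prod[of n 0] shifted_binom_eq_line_prod[of 0 n]
    by (simp add: symmetrized_prod_def smult_add_right line_prod_def)
  moreover have "(fact n :: complex) \<in> \<real>\<^sub>\<ge>\<^sub>0"
    by (metis nonneg_Reals_of_nat_I of_nat_fact)
  ultimately show ?thesis
    by (simp add: hstar_nonneg_smult hstar_nonneg_add hstar_nonneg_shifted_binom)
qed

lemma symmetrized_prod_upd_Suc:
  "symmetrized_prod (\<kappa>(m := c)) (Suc m) =
     [:1/2 + of_real c, 1:] * line_prod \<kappa> m + [:1/2 - of_real c, 1:] * line_prod (\<lambda>j. - \<kappa> j) m"
proof -
  have "line_prod (\<kappa>'(m := b)) m = line_prod \<kappa>' m" for \<kappa>' b by (simp add: line_prod_def)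
  moreover have "(\<lambda>j. - (\<kappa>(m := c)) j) = (\<lambda>j. - \<kappa> j)(m := - c)" by auto
  ultimately show ?thesis by (simp add: symmetrized_prod_def line_prod_Suc)
qed

lemma symmetrized_prod_interpolate:
  "symmetrized_prod (\<kappa>(m := \<sigma> * \<kappa> m)) (Suc m) =
     smult (of_real \<sigma>) (symmetrized_prod \<kappa> (Suc m)) +
     smult (of_real (1 - \<sigma>)) ([:1/2, 1:] * symmetrized_prod \<kappa> m)"
  unfolding symmetrized_prod_upd_Suc
  by (rule poly_ext) (simp add: symmetrized_prod_def line_prod_Suc field_simps)

lemma hstar_nonneg_symmetrized_half_int_upd:
  assumes "0 \<le> c" "c \<le> half_int m"
  shows "hstar_nonneg (Suc m) (symmetrized_prod (half_int(m := c)) (Suc m))"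
proof -
  define \<sigma> where "\<sigma> = c / half_int m"
  have \<sigma>: "0 \<le> \<sigma>" "\<sigma> \<le> 1" "c = \<sigma> * half_int m"
    unfolding \<sigma>_def using assms half_int_pos[of m] by auto
  then have "complex_of_real \<sigma> \<in> \<real>\<^sub>\<ge>\<^sub>0" "complex_of_real (1 - \<sigma>) \<in> \<real>\<^sub>\<ge>\<^sub>0"
    unfolding nonneg_Reals_of_real_iff by simp_all
  then show ?thesis
    unfolding \<sigma>(3) symmetrized_prod_interpolate
    by (intro hstar_nonneg_add hstar_nonneg_smult hstar_nonneg_half_shift_mult
        hstar_nonneg_symmetrized_half_int)
qed

section \<open>Arguments on the critical line\<close>

definition angle_sum :: "(nat \<Rightarrow> real) \<Rightarrow> nat \<Rightarrow> real \<Rightarrow> real" where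
  "angle_sum \<kappa> n y = (\<Sum>j<n. arctan (\<kappa> j / y))"

lemma angle_sum_uminus: "angle_sum (\<lambda>j. - \<kappa> j) n y = - angle_sum \<kappa> n y"
  by (simp add: angle_sum_def arctan_minus sum_negf)

lemma angle_sum_mono:
  assumes "y > 0" "m \<le> n" "\<And>j. \<kappa> j \<ge> 0"
  shows "angle_sum \<kappa> m y \<le> angle_sum \<kappa> n y"
  unfolding angle_sum_def using assms by (intro sum_mono2) (auto simp: zero_le_arctan_iff)

lemma angle_sum_nonneg:
  assumes "y > 0" "\<And>j. \<kappa> j \<ge> 0"
  shows "angle_sum \<kappa> n y \<ge> 0"
  using angle_sum_mono[OF assms(1), of 0 n \<kappa>] assms(2) by (simp add: angle_sum_def)

lemma angle_sum_antimono:
  assumes "0 < x" "x \<le> y" "\<And>j. \<kappa> j \<ge> 0"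
  shows "angle_sum \<kappa> n y \<le> angle_sum \<kappa> n x"
  unfolding angle_sum_def using assms by (intro sum_mono arctan_monotone' divide_left_mono) auto

lemma angle_sum_upd_eqE:
  assumes "y > 0" "0 < \<theta>" "\<theta> \<le> angle_sum \<kappa> n y"
  obtains m c where "m < n" "0 < c" "c \<le> \<kappa> m" "angle_sum (\<kappa>(m := c)) (Suc m) y = \<theta>"
proof -
  have "\<exists>m<n. (\<forall>i\<le>m. \<not> \<theta> \<le> angle_sum \<kappa> i y) \<and> \<theta> \<le> angle_sum \<kappa> (Suc m) y"
    using assms(2,3) by (intro ex_least_nat_less) (auto simp: angle_sum_def)
  then obtain m where crossing: "m < n" "angle_sum \<kappa> m y < \<theta>" "\<theta> \<le> angle_sum \<kappa> (Suc m) y"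
    using not_less by blast
  define \<alpha> where "\<alpha> = \<theta> - angle_sum \<kappa> m y"
  define c where "c = y * tan \<alpha>"
  have \<alpha>: "0 < \<alpha>" "\<alpha> \<le> arctan (\<kappa> m / y)" "\<alpha> < pi / 2"
    using crossing(2,3) arctan_ubound[of "\<kappa> m / y"] by (auto simp: \<alpha>_def angle_sum_def)
  then have arctan_eq: "arctan (c / y) = \<alpha>" using assms(1) by (simp add: c_def arctan_tan)
  show ?thesis
  proof (rule that[OF crossing(1)])
    show "0 < c" using assms(1) \<alpha> tan_gt_zero by (simp add: c_def)
    have "c / y \<le> \<kappa> m / y" using \<alpha>(2) arctan_eq arctan_le_iff by metis
    then show "c \<le> \<kappa> m" using assms(1) by (simp add: divide_le_cancel)
    show "angle_sum (\<kappa>(m := c)) (Suc m) y = \<theta>"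
      using arctan_eq by (simp add: angle_sum_def \<alpha>_def)
  qed
qed

lemma one_minus_ii_times_of_real: "1 - \<i> * of_real t = rcis (sqrt (1 + t\<^sup>2)) (- arctan t)"
proof -
  have "1 + t\<^sup>2 > 0" by (simp add: add_pos_nonneg)
  then show ?thesis by (simp add: complex_eq_iff cos_arctan sin_arctan)
qed

lemma poly_line_prod_critical_line:
  assumes "z \<in> critical_line" "Im z \<noteq> 0"
  shows "poly (line_prod \<kappa> n) z =
    (\<i> * of_real (Im z)) ^ n * rcis (\<Prod>j<n. sqrt (1 + (\<kappa> j / Im z)\<^sup>2)) (- angle_sum \<kappa> n (Im z))"
proof (induction n)
  case 0
  then show ?case by (simp add: line_prod_def angle_sum_def)
next
  case (Suc n)
  let ?r = "\<lambda>j. sqrt (1 + (\<kappa> j / Im z)\<^sup>2)"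
  have factor: "z + 1/2 + of_real (\<kappa> n) =
      (\<i> * of_real (Im z)) * rcis (?r n) (- arctan (\<kappa> n / Im z))"
    unfolding one_minus_ii_times_of_real[symmetric]
    using assms by (simp add: complex_eq_iff critical_line_def)
  have "poly (line_prod \<kappa> (Suc n)) z = (z + 1/2 + of_real (\<kappa> n)) * poly (line_prod \<kappa> n) z"
    by (simp add: poly_line_prod mult.commute)
  also have "\<dots> = (\<i> * of_real (Im z)) ^ Suc n *
      (rcis (?r n) (- arctan (\<kappa> n / Im z)) * rcis (\<Prod>j<n. ?r j) (- angle_sum \<kappa> n (Im z)))"
    unfolding factor Suc by (simp only: power_Suc mult_ac)
  also have "\<dots> =
      (\<i> * of_real (Im z)) ^ Suc n * rcis (\<Prod>j<Suc n. ?r j) (- angle_sum \<kappa> (Suc n) (Im z))"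
    by (simp add: rcis_mult angle_sum_def algebra_simps)
  finally show ?case .
qed

lemma poly_symmetrized_prod_eq_0:
  assumes "z \<in> critical_line" "Im z \<noteq> 0" "angle_sum \<kappa> n (Im z) = pi / 2"
  shows "poly (symmetrized_prod \<kappa> n) z = 0"
  using poly_line_prod_critical_line[OF assms(1,2), of \<kappa> n]
    poly_line_prod_critical_line[OF assms(1,2), of "\<lambda>j. - \<kappa> j" n]
  by (simp add: symmetrized_prod_def angle_sum_uminus assms(3) rcis_def)

lemma Re_shifted_binom_critical_line_pos:
  assumes "z \<in> critical_line" "Im z > 0" "i \<le> d" "angle_sum half_int d (Im z) < pi / 2"
  shows "Re (poly (shifted_binom d i) z / (\<i> * of_real (Im z)) ^ d) > 0"
proof -
  let ?\<theta> = "\<lambda>n. angle_sum half_int n (Im z)" and ?r = "\<lambda>n. \<Prod>j<n. sqrt (1 + (half_int j / Im z)\<^sup>2)"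
  have factors: "poly (line_prod half_int (d - i)) z =
        (\<i> * of_real (Im z)) ^ (d - i) * rcis (?r (d - i)) (- ?\<theta> (d - i))"
      "poly (line_prod (\<lambda>j. - half_int j) i) z = (\<i> * of_real (Im z)) ^ i * rcis (?r i) (?\<theta> i)"
    using assms(1,2) by (simp_all add: poly_line_prod_critical_line angle_sum_uminus)
  have "(\<i> * of_real (Im z)) ^ d = (\<i> * of_real (Im z)) ^ (d - i) * (\<i> * of_real (Im z)) ^ i"
    using assms(3) by (simp flip: power_add)
  then have "poly (shifted_binom d i) z =
      (\<i> * of_real (Im z)) ^ d * (rcis (?r (d - i)) (- ?\<theta> (d - i)) * rcis (?r i) (?\<theta> i)) / fact d"
    using shifted_binom_eq_line_prod[of "d - i" i] assms(3) by (simp add: factors mult_ac)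
  also have "\<dots> = (\<i> * of_real (Im z)) ^ d * rcis (?r (d - i) * ?r i / fact d) (?\<theta> i - ?\<theta> (d - i))"
    by (simp add: rcis_mult) (simp add: rcis_def)
  finally have "Re (poly (shifted_binom d i) z / (\<i> * of_real (Im z)) ^ d) =
      ?r (d - i) * ?r i / fact d * cos (?\<theta> i - ?\<theta> (d - i))"
    using assms(2) by simp
  moreover have "?r n > 0" for n by (intro prod_pos) (simp add: add_pos_nonneg)
  moreover have "cos (?\<theta> i - ?\<theta> (d - i)) > 0"
  proof (rule cos_gt_zero_pi)
    have "0 \<le> ?\<theta> n" "n \<le> d \<Longrightarrow> ?\<theta> n \<le> ?\<theta> d" for n
      using assms(2) by (auto intro!: angle_sum_nonneg angle_sum_mono less_imp_le[OF half_int_pos])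
    from this[of i] this[of "d - i"]
    show "- (pi / 2) < ?\<theta> i - ?\<theta> (d - i)" "?\<theta> i - ?\<theta> (d - i) < pi / 2"
      using assms(3,4) by auto
  qed
  ultimately show ?thesis by simp
qed

lemma nonneg_combination_right_half_plane_eq_0:
  assumes "finite A" "\<And>i. i \<in> A \<Longrightarrow> c i \<in> \<real>\<^sub>\<ge>\<^sub>0" "\<And>i. i \<in> A \<Longrightarrow> Re (w i) > 0"
    and "(\<Sum>i\<in>A. c i * w i) = 0" "i \<in> A"
  shows "c i = 0"
proof -
  have coeffs: "Re (c i) \<ge> 0" "Im (c i) = 0" if "i \<in> A" for i
    using assms(2)[OF that] by (simp_all add: complex_nonneg_Reals_iff)
  have "(\<Sum>i\<in>A. Re (c i) * Re (w i)) = Re (\<Sum>i\<in>A. c i * w i)"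
    unfolding Re_sum by (intro sum.cong) (simp_all add: coeffs)
  then have "(\<Sum>i\<in>A. Re (c i) * Re (w i)) = 0" using assms(4) by simp
  moreover have "Re (c i) * Re (w i) \<ge> 0" if "i \<in> A" for i
    using coeffs(1) assms(3) that by (intro mult_nonneg_nonneg) (auto intro: less_imp_le)
  ultimately have "Re (c i) * Re (w i) = 0"
    using assms(1,5) sum_nonneg_eq_0_iff[of A "\<lambda>i. Re (c i) * Re (w i)"] by auto
  then show ?thesis using assms(3)[OF assms(5)] coeffs(2)[OF assms(5)] by (simp add: complex_eq_iff)
qed

lemma hstar_nonneg_root_imp_angle_sum_ge:
  assumes "hstar_nonneg d p" "p \<noteq> 0" "poly p z = 0" "z \<in> critical_line" "Im z > 0"
  shows "angle_sum half_int d (Im z) \<ge> pi / 2"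
proof (rule ccontr)
  assume small: "\<not> angle_sum half_int d (Im z) \<ge> pi / 2"
  let ?h = "fps_nth (hstar_series d p)"
  define w where "w = (\<lambda>i. poly (shifted_binom d i) z / (\<i> * of_real (Im z)) ^ d)"
  have expansion: "p = (\<Sum>i\<le>d. smult (?h i) (shifted_binom d i))"
    using assms(1) by (intro hstar_binom_expansion) (simp add: hstar_nonneg_def)
  have "(\<Sum>i\<le>d. ?h i * w i) =
      poly (\<Sum>i\<le>d. smult (?h i) (shifted_binom d i)) z / (\<i> * of_real (Im z)) ^ d"
    by (simp add: w_def poly_sum sum_divide_distrib)
  also have "\<dots> = 0" using assms(3) expansion by simp
  finally have "(\<Sum>i\<le>d. ?h i * w i) = 0" .
  moreover have "Re (w i) > 0" if "i \<le> d" for i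
    unfolding w_def using assms(4,5) small that by (intro Re_shifted_binom_critical_line_pos) auto
  ultimately have "?h i = 0" if "i \<le> d" for i
    using that assms(1) nonneg_combination_right_half_plane_eq_0[of "{..d}" ?h w i]
    by (simp add: hstar_nonneg_def)
  then have "p = 0" by (subst expansion) simp
  then show False using assms(2) by blast
qed

section \<open>The shape of the set of roots\<close>

lemma Omega_iff_hstar_nonneg:
  "z \<in> Omega d \<longleftrightarrow> z \<in> critical_line \<and> (\<exists>p. CL_poly d p \<and> hstar_nonneg d p \<and> poly p z = 0)"
  unfolding Omega_def using diamond_iff_hstar_nonneg by auto

lemma Omega_subset_Suc: "Omega n \<subseteq> Omega (Suc n)"
proof
  fix z assume "z \<in> Omega n"
  then obtain p where p: "z \<in> critical_line" "CL_poly n p" "hstar_nonneg n p" "poly p z = 0"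
    unfolding Omega_iff_hstar_nonneg by blast
  have "CL_poly (Suc n) ([:1/2, 1:] * p)" using CL_poly_mult[OF CL_poly_half_shift p(2)] by simp
  moreover have "hstar_nonneg (Suc n) ([:1/2, 1:] * p)"
    by (rule hstar_nonneg_half_shift_mult[OF p(3)])
  moreover have "poly ([:1/2, 1:] * p) z = 0" using p(4) by simp
  ultimately show "z \<in> Omega (Suc n)" unfolding Omega_iff_hstar_nonneg using p(1) by blast
qed

lemma Omega_mono: "m \<le> n \<Longrightarrow> Omega m \<subseteq> Omega n"
  by (rule lift_Suc_mono_le[of Omega]) (rule Omega_subset_Suc)

lemma cnj_in_Omega:
  assumes "z \<in> Omega d"
  shows "cnj z \<in> Omega d"
proof -
  obtain p where p: "z \<in> critical_line" "CL_poly d p" "diamond p" "poly p z = 0"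
    using assms unfolding Omega_def by blast
  then have "poly p (cnj z) = 0"
    using poly_reflection_symmetric[of p z]
    by (simp add: cnj_critical_line CL_poly_iff critical_symmetric_def)
  moreover have "cnj z \<in> critical_line" using p(1) by (simp add: critical_line_def)
  ultimately show ?thesis unfolding Omega_def using p by blast
qed

lemma critical_line_Im_0_in_Omega:
  assumes "d > 0" "z \<in> critical_line" "Im z = 0"
  shows "z \<in> Omega d"
proof -
  let ?p = "symmetrized_prod half_int 1"
  have "CL_poly 1 ?p" by (intro CL_poly_symmetrized_prod half_int_pos)
  moreover have "hstar_nonneg 1 ?p" by (rule hstar_nonneg_symmetrized_half_int)
  moreover have "poly ?p z = 0"
    using assms(2,3)
    by (simp add: symmetrized_prod_def poly_line_prod complex_eq_iff critical_line_def)
  ultimately have "z \<in> Omega 1" unfolding Omega_iff_hstar_nonneg using assms(2) by blast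
  then show ?thesis using Omega_mono[of 1 d] assms(1) by auto
qed

lemma upper_critical_line_in_Omega_iff:
  assumes "z \<in> critical_line" "Im z > 0"
  shows "z \<in> Omega d \<longleftrightarrow> angle_sum half_int d (Im z) \<ge> pi / 2"
proof
  assume "z \<in> Omega d"
  then obtain p where p: "CL_poly d p" "hstar_nonneg d p" "poly p z = 0"
    unfolding Omega_iff_hstar_nonneg by blast
  moreover have "p \<noteq> 0" using p(1) critical_symmetric_nonzero by (simp add: CL_poly_iff)
  ultimately show "angle_sum half_int d (Im z) \<ge> pi / 2"
    using assms hstar_nonneg_root_imp_angle_sum_ge by blast
next
  assume "angle_sum half_int d (Im z) \<ge> pi / 2"
  then obtain m c where "m < d" and c_bounds: "0 < c" "c \<le> half_int m"
    and angle: "angle_sum (half_int(m := c)) (Suc m) (Im z) = pi / 2"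
    using angle_sum_upd_eqE[OF assms(2), of "pi / 2" half_int d] by auto
  let ?p = "symmetrized_prod (half_int(m := c)) (Suc m)"
  have "CL_poly (Suc m) ?p"
    using c_bounds(1) by (intro CL_poly_symmetrized_prod) (simp add: half_int_pos)
  moreover have "hstar_nonneg (Suc m) ?p"
    using c_bounds by (intro hstar_nonneg_symmetrized_half_int_upd) auto
  moreover have "poly ?p z = 0" using assms angle by (intro poly_symmetrized_prod_eq_0) auto
  ultimately have "z \<in> Omega (Suc m)" unfolding Omega_iff_hstar_nonneg using assms(1) by blast
  then show "z \<in> Omega d" using Omega_mono[of "Suc m" d] \<open>m < d\<close> by auto
qed

lemma Omega_iff_angle_sum:
  assumes "d > 0"
  shows "z \<in> Omega d \<longleftrightarrow>
    z \<in> critical_line \<and> (Im z = 0 \<or> angle_sum half_int d \<bar>Im z\<bar> \<ge> pi / 2)"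
proof (cases "z \<in> critical_line")
  case True
  show ?thesis
  proof (cases "Im z" "0 :: real" rule: linorder_cases)
    case less
    have "cnj z \<in> critical_line" using True by (simp add: critical_line_def)
    moreover have "z \<in> Omega d \<longleftrightarrow> cnj z \<in> Omega d"
      using cnj_in_Omega[of z d] cnj_in_Omega[of "cnj z" d] by auto
    ultimately show ?thesis using upper_critical_line_in_Omega_iff[of "cnj z" d] less True by simp
  next
    case equal
    then show ?thesis using critical_line_Im_0_in_Omega[OF assms True] True by simp
  next
    case greater
    then show ?thesis using upper_critical_line_in_Omega_iff[OF True] True by simp
  qed
qed (simp add: Omega_def)

lemma connected_angle_sum_ge:
  assumes "\<And>j. \<kappa> j \<ge> 0"
  shows "connected {y. y = 0 \<or> angle_sum \<kappa> n \<bar>y\<bar> \<ge> \<theta>}" (is "connected ?S")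
  unfolding connected_iff_interval
proof (intro ballI allI impI)
  fix a b y assume ends: "a \<in> ?S" "b \<in> ?S" and between: "a \<le> y" "y \<le> b"
  show "y \<in> ?S"
  proof (cases "y = 0")
    case False
    have "\<bar>y\<bar> \<le> \<bar>a\<bar> \<or> \<bar>y\<bar> \<le> \<bar>b\<bar>" using between by auto
    then obtain x where x: "x \<in> ?S" "\<bar>y\<bar> \<le> \<bar>x\<bar>" using ends by blast
    then have "\<theta> \<le> angle_sum \<kappa> n \<bar>x\<bar>" using False by auto
    also have "\<dots> \<le> angle_sum \<kappa> n \<bar>y\<bar>"
      using x(2) False assms by (intro angle_sum_antimono) auto
    finally show ?thesis by simp
  qed simp
qed

theorem theorem3p10:
  fixes d :: nat
  assumes "d > 0"
  shows "connected (Omega d)"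
proof -
  let ?S = "{y. y = 0 \<or> angle_sum half_int d \<bar>y\<bar> \<ge> pi / 2}"
  have "connected ?S" by (intro connected_angle_sum_ge less_imp_le half_int_pos)
  then have "connected (Complex (- 1/2) ` ?S)"
    by (intro connected_continuous_image continuous_intros)
  also have "Complex (- 1/2) ` ?S = Omega d"
    by (auto simp: Omega_iff_angle_sum[OF assms] critical_line_def image_iff complex_eq_iff)
  finally show ?thesis .
qed

end
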